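(* Let $\mathcal{M}$ and $\mathcal{N}$ be two matroids on the same finite ground set $V$. Then \[\chi_\ell(\mathcal{M}\cap\mathcal{N})\le \chi(\mathcal{M})+\chi(\mathcal{N}).\]
   Context: A (finite) matroid on $V$ is a nonempty family $\mathcal{M}$ of subsets of $V$ (the independent sets) that is closed under taking subsets and satisfies the augmentation axiom: if $S,T\in\mathcal{M}$ and $|S|<|T|$, there is $v\in T\setminus S$ with $S\cup\{v\}\in\mathcal{M}$. Throughout, the convention is that every element of the ground set of a complex (family of sets closed under subsets) belongs to some set of the complex; in particular every element of $V$ is independent in $\mathcal{M}$ and in $\mathcal{N}$. $\mathcal{M}\cap\mathcal{N}$ is the complex of sets independent in both. For a complex $\mathcal{C}$ on ground set $V$: the chromatic number $\chi(\mathcal{C})$ is the minimum number of sets in $\mathcal{C}$ whose union is $V$; the list chromatic number $\chi_\ell(\mathcal{C})$ is the minimum $k$ such that for every assignment of lists $(L_v)_{v\in V}$ of colors with $|L_v|=k$, there is a function $f$ on $V$ with $f(v)\in L_v$ for all $v$ and $f^{-1}(c)\in\mathcal{C}$ for every color $c$. *)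

theory Defs
  imports Main
begin

(* The last conjunct is the convention that every element of the ground set lies in some set
   of the complex; for matroids it rules out loops. *)
definition complex_on :: "'a set \<Rightarrow> 'a set set \<Rightarrow> bool" where
  "complex_on V C \<longleftrightarrow>
     C \<noteq> {} \<and> C \<subseteq> Pow V \<and> (\<forall>S\<in>C. \<forall>T. T \<subseteq> S \<longrightarrow> T \<in> C) \<and> (\<forall>v\<in>V. \<exists>S\<in>C. v \<in> S)"

definition matroid_on :: "'a set \<Rightarrow> 'a set set \<Rightarrow> bool" where
  "matroid_on V M \<longleftrightarrow>
     finite V \<and> complex_on V M \<and>
     (\<forall>S\<in>M. \<forall>T\<in>M. card S < card T \<longrightarrow> (\<exists>v\<in>T - S. insert v S \<in> M))"

definition chromatic_number :: "'a set \<Rightarrow> 'a set set \<Rightarrow> nat" where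
  "chromatic_number V C = (LEAST n. \<exists>F. F \<subseteq> C \<and> finite F \<and> card F = n \<and> \<Union>F = V)"

(* Colours are natural numbers. For a finite ground set this is no restriction: finitely many
   finite lists only involve finitely many colours. *)
definition list_colorable :: "'a set \<Rightarrow> 'a set set \<Rightarrow> nat \<Rightarrow> bool" where
  "list_colorable V C k \<longleftrightarrow>
     (\<forall>L :: 'a \<Rightarrow> nat set. (\<forall>v\<in>V. finite (L v) \<and> card (L v) = k) \<longrightarrow>
        (\<exists>f. (\<forall>v\<in>V. f v \<in> L v) \<and> (\<forall>c. {v\<in>V. f v = c} \<in> C)))"

definition list_chromatic_number :: "'a set \<Rightarrow> 'a set set \<Rightarrow> nat" where
  "list_chromatic_number V C = (LEAST k. list_colorable V C k)"

(* For a complex on a finite ground set both LEASTs are genuine minima, i.e. attained. *)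

lemma complex_on_singleton: "complex_on V C \<Longrightarrow> v \<in> V \<Longrightarrow> {v} \<in> C"
proof -
  assume C: "complex_on V C" and v: "v \<in> V"
  from C have "\<forall>v\<in>V. \<exists>S\<in>C. v \<in> S" unfolding complex_on_def by simp
  with v obtain S where "S \<in> C" "v \<in> S" by auto
  then have "S \<in> C" "{v} \<subseteq> S" by simp_all
  then show "{v} \<in> C" using C unfolding complex_on_def by simp
qed

lemma complex_on_empty: "complex_on V C \<Longrightarrow> {} \<in> C"
proof -
  assume C: "complex_on V C"
  then obtain S where "S \<in> C" unfolding complex_on_def by auto
  moreover have "{} \<subseteq> S" by simp
  ultimately show "{} \<in> C" using C unfolding complex_on_def by simp
qed

lemma chromatic_number_attained:
  assumes "finite V" "complex_on V C"
  shows "\<exists>F. F \<subseteq> C \<and> finite F \<and> card F = chromatic_number V C \<and> \<Union>F = V"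
proof -
  let ?F = "(\<lambda>v. {v}) ` V"
  have "?F \<subseteq> C \<and> finite ?F \<and> card ?F = card ?F \<and> \<Union>?F = V"
    using assms complex_on_singleton by auto
  then have "\<exists>n F. F \<subseteq> C \<and> finite F \<and> card F = n \<and> \<Union>F = V" by blast
  then show ?thesis unfolding chromatic_number_def by (rule LeastI_ex)
qed

lemma list_colorable_card:
  assumes "finite V" "complex_on V C"
  shows "list_colorable V C (card V)"
proof -
  have inj: "\<exists>f. (\<forall>v\<in>W. f v \<in> L v) \<and> inj_on f W"
    if "finite W" "\<forall>v\<in>W. finite (L v) \<and> card W \<le> card (L v)"
    for W :: "'a set" and L :: "'a \<Rightarrow> nat set"
    using that
  proof (induction W rule: finite_induct)
    case (insert x W)
    then obtain f where f: "\<forall>v\<in>W. f v \<in> L v" "inj_on f W" by (auto simp: Suc_le_eq dest: less_imp_le)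
    have "card (f ` W) < card (L x)"
      using insert.hyps insert.prems card_image_le[OF insert.hyps(1), of f] by simp
    then obtain c where c: "c \<in> L x" "c \<notin> f ` W"
      using insert.hyps(1) by (metis card_mono finite_imageI leD subsetI)
    have "\<forall>v\<in>insert x W. (f(x := c)) v \<in> L v" "inj_on (f(x := c)) (insert x W)"
      using f c insert.hyps(2) by (auto simp: inj_on_def)
    then show ?case by blast
  qed simp
  show ?thesis
    unfolding list_colorable_def
  proof (intro allI impI)
    fix L :: "'a \<Rightarrow> nat set"
    assume "\<forall>v\<in>V. finite (L v) \<and> card (L v) = card V"
    then obtain f where f: "\<forall>v\<in>V. f v \<in> L v" "inj_on f V"
      using inj[OF assms(1), of L] by auto
    have "{v\<in>V. f v = c} \<in> C" for c
    proof (cases "\<exists>v\<in>V. f v = c")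
      case True
      then obtain v where v: "v \<in> V" "f v = c" by blast
      then have "{u\<in>V. f u = c} = {v}" using f(2) by (auto simp: inj_on_def)
      then show ?thesis using v complex_on_singleton[OF assms(2)] by simp
    next
      case False
      then have "{v\<in>V. f v = c} = {}" by blast
      then show ?thesis using complex_on_empty[OF assms(2)] by metis
    qed
    then show "\<exists>f. (\<forall>v\<in>V. f v \<in> L v) \<and> (\<forall>c. {v\<in>V. f v = c} \<in> C)" using f(1) by blast
  qed
qed

lemma list_chromatic_number_attained:
  "finite V \<Longrightarrow> complex_on V C \<Longrightarrow> list_colorable V C (list_chromatic_number V C)"
  unfolding list_chromatic_number_def by (rule LeastI) (rule list_colorable_card)

lemma complex_on_Int:
  assumes "complex_on V C" "complex_on V D"
  shows "complex_on V (C \<inter> D)"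
  unfolding complex_on_def
proof (intro conjI ballI)
  show "C \<inter> D \<noteq> {}"
    using assms[THEN complex_on_empty] by auto
  show "C \<inter> D \<subseteq> Pow V"
    using assms(1) unfolding complex_on_def by (simp add: le_infI1)
  have "T \<in> E" if "complex_on V E" "S \<in> E" "T \<subseteq> S" for E S T
    using that unfolding complex_on_def by simp
  then show "\<forall>T. T \<subseteq> S \<longrightarrow> T \<in> C \<inter> D" if "S \<in> C \<inter> D" for S
    using assms that by (metis IntD1 IntD2 IntI)
  show "\<exists>S\<in>C \<inter> D. v \<in> S" if "v \<in> V" for v
    using assms that by (intro bexI[of _ "{v}"]) (simp_all add: complex_on_singleton)
qed

end

theory Submission
  imports Defs Complex_Main
begin

text \<open>
  Given lists of size \<open>\<chi>(M) + \<chi>(N)\<close>, let \<open>W\<close> be the set of pairs (vertex, colour from its list) and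
  lift \<open>M\<close> and \<open>N\<close> to \<open>W\<close> colour by colour. A list colouring is a common independent set of
  the lifts that contains exactly one pair over each vertex. By the topological Hall theorem it
  exists once, for every nonempty set \<open>X\<close> of vertices, the complex of common independent sets in the
  part \<open>Y\<close> of \<open>W\<close> over \<open>X\<close> has no real homology on faces of size \<open>r = |X| - 1\<close>.

  This vanishing is a spectral gap. On the full simplex over \<open>Y\<close> the Laplacian is \<open>|Y|\<close> times the
  identity. If \<open>\<phi>\<close> lives on independent \<open>r\<close>-sets of a matroid, then a dependent \<open>(r + 1)\<close>-set on which
  the coboundary of \<open>\<phi>\<close> is nonzero spans a unique flat of rank \<open>r\<close>; the simplex identity on each
  flat bounds the energy lost on dependent sets by the maximal size of such a flat, which is at most
  \<open>r \<chi>\<close>. The losses of the two matroids add up, so the Laplacian of the intersection is at least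
  \<open>|Y| - r (\<chi>(M) + \<chi>(N)) = \<chi>(M) + \<chi>(N) > 0\<close>.
\<close>

section \<open>Signed coboundary and boundary operators\<close>

text \<open>The sign is the parity of the number of elements of \<open>S\<close> preceding
  \<open>x\<close>. Only strict predecessors count, so it does not matter whether \<open>x\<close>
  itself lies in \<open>S\<close>, and one formula serves both operators.\<close>

definition inc :: "('a \<Rightarrow> nat) \<Rightarrow> 'a \<Rightarrow> 'a set \<Rightarrow> real" where
  "inc g x S = (- 1) ^ card {y \<in> S. g y < g x}"

text \<open>The vertices are ordered by the injection \<open>g\<close>; the boundary is taken inside the vertex set \<open>U\<close>.\<close>

definition cob :: "('a \<Rightarrow> nat) \<Rightarrow> ('a set \<Rightarrow> real) \<Rightarrow> 'a set \<Rightarrow> real" where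
  "cob g \<phi> T = (\<Sum>x\<in>T. inc g x T * \<phi> (T - {x}))"

definition bd :: "('a \<Rightarrow> nat) \<Rightarrow> 'a set \<Rightarrow> ('a set \<Rightarrow> real) \<Rightarrow> 'a set \<Rightarrow> real" where
  "bd g U \<phi> S = (\<Sum>x\<in>U - S. inc g x S * \<phi> (insert x S))"

lemma inc_mult_self [simp]: "inc g x S * inc g x S = 1"
  by (simp add: inc_def flip: power_add mult_2)

lemma inc_nonzero [simp]: "inc g x S \<noteq> 0"
  by (simp add: inc_def)

lemma inc_remove_self [simp]: "inc g x (S - {x}) = inc g x S"
proof -
  have "{y \<in> S - {x}. g y < g x} = {y \<in> S. g y < g x}" by auto
  then show ?thesis by (simp add: inc_def)
qed

lemma inc_insert_self [simp]: "inc g x (insert x S) = inc g x S"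
proof -
  have "{y \<in> insert x S. g y < g x} = {y \<in> S. g y < g x}" by auto
  then show ?thesis by (simp add: inc_def)
qed

lemma inc_insert:
  assumes "finite S" "y \<notin> S"
  shows "inc g x (insert y S) = (if g y < g x then - inc g x S else inc g x S)"
proof (cases "g y < g x")
  case True
  then have "{z \<in> insert y S. g z < g x} = insert y {z \<in> S. g z < g x}" by auto
  then show ?thesis using assms True by (simp add: inc_def)
next
  case False
  then have "{z \<in> insert y S. g z < g x} = {z \<in> S. g z < g x}" by auto
  then show ?thesis using False by (simp add: inc_def)
qed

text \<open>One of the two elements precedes the other, so exactly one of
  \<open>inc g y (insert x S)\<close> and \<open>inc g x (insert y S)\<close> flips relative to its
  value at \<open>S\<close>. This rule drives the cancellations in \<open>bd_bd\<close> and
  \<open>cob_bd_plus_bd_cob\<close>.\<close>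

lemma inc_swap:
  assumes "finite S" "x \<notin> S" "y \<notin> S" "g x \<noteq> g y"
  shows "inc g x S * inc g y (insert x S) = - (inc g y S * inc g x (insert y S))"
  using assms by (auto simp: inc_insert)

lemma sum_antisym_zero:
  fixes h :: "'a \<Rightarrow> 'a \<Rightarrow> real"
  assumes "\<And>x y. x \<in> A \<Longrightarrow> y \<in> A \<Longrightarrow> h x y = - h y x"
  shows "(\<Sum>x\<in>A. \<Sum>y\<in>A. h x y) = 0"
proof -
  have "(\<Sum>x\<in>A. \<Sum>y\<in>A. h x y) = (\<Sum>x\<in>A. \<Sum>y\<in>A. - h y x)"
    by (intro sum.cong refl assms)
  also have "\<dots> = - (\<Sum>x\<in>A. \<Sum>y\<in>A. h y x)" by (simp add: sum_negf)
  also have "(\<Sum>x\<in>A. \<Sum>y\<in>A. h y x) = (\<Sum>x\<in>A. \<Sum>y\<in>A. h x y)" by (rule sum.swap)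
  finally show ?thesis by simp
qed

lemma bd_bd:
  assumes "finite U" "inj_on g U" "S \<subseteq> U"
  shows "bd g U (bd g U \<phi>) S = 0"
proof -
  \<comment> \<open>Zero on the diagonal, so that the sum over ordered pairs of distinct vertices
    runs over a full square and antisymmetry applies.\<close>
  let ?h = "\<lambda>x y. if x = y then 0 else
      inc g x S * inc g y (insert x S) * \<phi> (insert y (insert x S))"
  have fS: "finite S" using assms finite_subset by blast
  have "bd g U (bd g U \<phi>) S = (\<Sum>x\<in>U - S. \<Sum>y\<in>U - S. ?h x y)"
    unfolding bd_def
  proof (rule sum.cong[OF refl])
    fix x assume x: "x \<in> U - S"
    have "(\<Sum>y\<in>U - S. ?h x y) = (\<Sum>y\<in>U - S - {x}. ?h x y)"
      using assms(1) by (intro sum.mono_neutral_right) auto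
    also have "\<dots> = (\<Sum>y\<in>U - insert x S. ?h x y)"
      by (rule sum.cong) auto
    also have "\<dots> = (\<Sum>y\<in>U - insert x S.
        inc g x S * (inc g y (insert x S) * \<phi> (insert y (insert x S))))"
      by (rule sum.cong) auto
    finally show "inc g x S *
        (\<Sum>y\<in>U - insert x S. inc g y (insert x S) * \<phi> (insert y (insert x S))) =
        (\<Sum>y\<in>U - S. ?h x y)"
      by (simp add: sum_distrib_left)
  qed
  also have "\<dots> = 0"
  proof (rule sum_antisym_zero)
    fix x y assume "x \<in> U - S" "y \<in> U - S"
    moreover from this have "x \<noteq> y \<Longrightarrow> g x \<noteq> g y"
      using assms(2) by (auto dest: inj_onD)
    ultimately show "?h x y = - ?h y x"
      using inc_swap[OF fS, of x y g] by (auto simp: insert_commute)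
  qed
  finally show ?thesis .
qed

text \<open>Removing and restoring a vertex of \<open>S\<close> gives \<open>card S\<close> copies
  of \<open>\<phi> S\<close>, adding and removing an outside vertex gives
  \<open>card (U - S)\<close> copies. The terms exchanging \<open>x\<close> in \<open>S\<close> for
  \<open>y\<close> outside occur in both products with opposite signs. The empty set counts as a
  face, so \<open>S = {}\<close> is no exception.\<close>

lemma cob_bd_plus_bd_cob:
  fixes \<phi> :: "'a set \<Rightarrow> real"
  assumes "finite U" "inj_on g U" "S \<subseteq> U"
  shows "cob g (bd g U \<phi>) S + bd g U (cob g \<phi>) S = card U * \<phi> S"
proof -
  have fS: "finite S" using assms finite_subset by blast
  let ?a = "\<lambda>x y. inc g x S * (inc g y (S - {x}) * \<phi> (insert y (S - {x})))"
  let ?b = "\<lambda>x y. inc g y S * (inc g x (insert y S) * \<phi> (insert y (S - {x})))"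
  have A: "cob g (bd g U \<phi>) S = card S * \<phi> S + (\<Sum>x\<in>S. \<Sum>y\<in>U - S. ?a x y)"
  proof -
    have "cob g (bd g U \<phi>) S = (\<Sum>x\<in>S. \<phi> S + (\<Sum>y\<in>U - S. ?a x y))"
      unfolding cob_def bd_def
    proof (rule sum.cong[OF refl])
      fix x assume x: "x \<in> S"
      have "U - (S - {x}) = insert x (U - S)" using x assms by auto
      then show "inc g x S * (\<Sum>y\<in>U - (S - {x}). inc g y (S - {x}) * \<phi> (insert y (S - {x})))
          = \<phi> S + (\<Sum>y\<in>U - S. ?a x y)"
        using x assms(1)
        by (simp add: sum_distrib_left distrib_left insert_absorb flip: mult.assoc)
    qed
    then show ?thesis by (simp add: sum.distrib)
  qed
  have B: "bd g U (cob g \<phi>) S = card (U - S) * \<phi> S + (\<Sum>y\<in>U - S. \<Sum>x\<in>S. ?b x y)"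
  proof -
    have "bd g U (cob g \<phi>) S = (\<Sum>y\<in>U - S. \<phi> S + (\<Sum>x\<in>S. ?b x y))"
      unfolding cob_def bd_def
    proof (rule sum.cong[OF refl])
      fix y assume y: "y \<in> U - S"
      have "(\<Sum>x\<in>S. inc g x (insert y S) * \<phi> (insert y S - {x}))
          = (\<Sum>x\<in>S. inc g x (insert y S) * \<phi> (insert y (S - {x})))"
        using y by (intro sum.cong refl) (metis DiffD2 insert_Diff_if singletonD)
      then show "inc g y S * (\<Sum>x\<in>insert y S. inc g x (insert y S) * \<phi> (insert y S - {x}))
          = \<phi> S + (\<Sum>x\<in>S. ?b x y)"
        using y fS by (simp add: sum_distrib_left distrib_left flip: mult.assoc)
    qed
    then show ?thesis by (simp add: sum.distrib)
  qed
  have "(\<Sum>y\<in>U - S. \<Sum>x\<in>S. ?b x y) = (\<Sum>x\<in>S. \<Sum>y\<in>U - S. ?b x y)" by (rule sum.swap)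
  also have "\<dots> = (\<Sum>x\<in>S. \<Sum>y\<in>U - S. - ?a x y)"
  proof (intro sum.cong refl)
    fix x y assume x: "x \<in> S" and y: "y \<in> U - S"
    have "g x \<noteq> g y" using x y assms by (auto dest: inj_onD)
    \<comment> \<open>The signs are compared over the common part \<open>S - {x}\<close>, where
      \<open>inc_swap\<close> applies.\<close>
    moreover have "insert y S = insert x (insert y (S - {x}))" using x by auto
    then have "inc g x (insert y S) = inc g x (insert y (S - {x}))" by (metis inc_insert_self)
    moreover have "inc g y S = inc g y (insert x (S - {x}))" using x by (simp add: insert_absorb)
    moreover have "inc g x S * inc g y (insert x (S - {x})) =
        - (inc g y (S - {x}) * inc g x (insert y (S - {x})))"
      using inc_swap[of "S - {x}" x y g] fS y calculation(1) by simp
    ultimately have "inc g y S * inc g x (insert y S) = - (inc g x S * inc g y (S - {x}))"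
      using inc_insert[of "S - {x}" x g y] inc_insert[of "S - {x}" y g x] fS x y
      by (auto simp: insert_absorb split: if_splits)
    then show "?b x y = - ?a x y" by (simp flip: mult.assoc)
  qed
  finally have C: "(\<Sum>y\<in>U - S. \<Sum>x\<in>S. ?b x y) = - (\<Sum>x\<in>S. \<Sum>y\<in>U - S. ?a x y)"
    by (simp add: sum_negf)
  have "card U = card S + card (U - S)"
    using assms fS by (metis card_Diff_subset card_mono le_add_diff_inverse)
  then show ?thesis unfolding A B C by (simp add: algebra_simps)
qed

text \<open>Adjointness: both sides sum over the same incidences, indexed on the left by
  \<open>T\<close> with \<open>x\<close> in \<open>T\<close> and on the right by
  \<open>S = T - {x}\<close> with \<open>x\<close> outside \<open>S\<close>.\<close>

lemma sum_cob_mult: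
  assumes "finite U"
  shows "(\<Sum>T\<in>Pow U. cob g \<phi> T * \<psi> T) = (\<Sum>S\<in>Pow U. \<phi> S * bd g U \<psi> S)"
proof -
  have fin: "finite T" if "T \<in> Pow U" for T using that assms finite_subset by auto
  have "(\<Sum>T\<in>Pow U. cob g \<phi> T * \<psi> T)
      = (\<Sum>T\<in>Pow U. \<Sum>x\<in>T. inc g x T * \<phi> (T - {x}) * \<psi> T)"
    by (simp add: cob_def sum_distrib_right)
  also have "\<dots> = (\<Sum>(T, x)\<in>Sigma (Pow U) (\<lambda>T. T). inc g x T * \<phi> (T - {x}) * \<psi> T)"
    using assms fin by (intro sum.Sigma) auto
  also have "\<dots> = (\<Sum>(S, x)\<in>Sigma (Pow U) (\<lambda>S. U - S). \<phi> S * (inc g x S * \<psi> (insert x S)))"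
    by (rule sum.reindex_bij_witness[where i = "\<lambda>(S, x). (insert x S, x)"
          and j = "\<lambda>(T, x). (T - {x}, x)"]) (auto simp: insert_absorb)
  also have "\<dots> = (\<Sum>S\<in>Pow U. \<Sum>x\<in>U - S. \<phi> S * (inc g x S * \<psi> (insert x S)))"
    using assms by (intro sum.Sigma[symmetric]) auto
  also have "\<dots> = (\<Sum>S\<in>Pow U. \<phi> S * bd g U \<psi> S)"
    by (simp add: bd_def sum_distrib_left)
  finally show ?thesis .
qed

text \<open>The pointwise Laplacian identity is paired with \<open>\<phi>\<close>, and adjointness
  turns the two pairings into squared norms.\<close>

lemma sum_cob_sq_plus_sum_bd_sq:
  fixes \<phi> :: "'a set \<Rightarrow> real"
  assumes "finite U" "inj_on g U"
  shows "(\<Sum>T\<in>Pow U. (cob g \<phi> T)\<^sup>2) + (\<Sum>S\<in>Pow U. (bd g U \<phi> S)\<^sup>2)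
      = card U * (\<Sum>S\<in>Pow U. (\<phi> S)\<^sup>2)"
proof -
  have "(\<Sum>T\<in>Pow U. (cob g \<phi> T)\<^sup>2) + (\<Sum>S\<in>Pow U. (bd g U \<phi> S)\<^sup>2)
      = (\<Sum>T\<in>Pow U. cob g \<phi> T * cob g \<phi> T) + (\<Sum>S\<in>Pow U. bd g U \<phi> S * bd g U \<phi> S)"
    by (simp add: power2_eq_square)
  also have "\<dots> = (\<Sum>S\<in>Pow U. \<phi> S * bd g U (cob g \<phi>) S)
      + (\<Sum>T\<in>Pow U. cob g (bd g U \<phi>) T * \<phi> T)"
    by (simp only: sum_cob_mult[OF assms(1)])
  also have "\<dots> = (\<Sum>S\<in>Pow U. \<phi> S * (cob g (bd g U \<phi>) S + bd g U (cob g \<phi>) S))"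
    by (simp add: sum.distrib[symmetric] algebra_simps)
  also have "\<dots> = (\<Sum>S\<in>Pow U. card U * (\<phi> S)\<^sup>2)"
    using cob_bd_plus_bd_cob[OF assms] by (intro sum.cong refl) (auto simp: power2_eq_square)
  finally show ?thesis by (simp add: sum_distrib_left)
qed

lemma sum_cob_sq_le:
  fixes \<phi> :: "'a set \<Rightarrow> real"
  assumes "finite U" "inj_on g U"
  shows "(\<Sum>T\<in>Pow U. (cob g \<phi> T)\<^sup>2) \<le> card U * (\<Sum>S\<in>Pow U. (\<phi> S)\<^sup>2)"
  using sum_cob_sq_plus_sum_bd_sq[OF assms, of \<phi>] sum_nonneg[of "Pow U" "\<lambda>S. (bd g U \<phi> S)\<^sup>2"]
  by simp

lemma bd_supported:
  assumes "finite W" "U \<subseteq> W" "\<And>S. \<phi> S \<noteq> 0 \<Longrightarrow> S \<subseteq> U"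
  shows "bd g W \<phi> S = bd g U \<phi> S"
  unfolding bd_def using assms by (intro sum.mono_neutral_right) auto

section \<open>Matroids\<close>

definition span_on :: "'a set \<Rightarrow> 'a set set \<Rightarrow> 'a set \<Rightarrow> 'a set" where
  "span_on V M S = {y \<in> V. y \<in> S \<or> insert y S \<notin> M}"

lemma matroid_subset: "matroid_on V M \<Longrightarrow> S \<in> M \<Longrightarrow> T \<subseteq> S \<Longrightarrow> T \<in> M"
  by (auto simp: matroid_on_def complex_on_def)

lemma matroid_carrier: "matroid_on V M \<Longrightarrow> S \<in> M \<Longrightarrow> S \<subseteq> V"
  by (auto simp: matroid_on_def complex_on_def)

lemma matroid_finite: "matroid_on V M \<Longrightarrow> finite V"
  by (simp add: matroid_on_def)

lemma matroid_augment:
  assumes "matroid_on V M" "S \<in> M" "T \<in> M" "card S < card T"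
  obtains v where "v \<in> T - S" "insert v S \<in> M"
  using assms unfolding matroid_on_def by blast

text \<open>If \<open>y\<close> lay in the first span only, \<open>S\<close> could be augmented from
  \<open>insert y S'\<close>. The new element is not \<open>y\<close>, hence lies in
  \<open>S'\<close>, and the result is an independent set filling all of \<open>T\<close>. By
  symmetry all independent facets of a dependent set span the same flat.\<close>

lemma span_on_subset:
  assumes M: "matroid_on V M" and T: "finite T" "T \<notin> M" "card T = Suc r"
    and S: "S \<in> M" "S \<subseteq> T" "card S = r" and S': "S' \<in> M" "S' \<subseteq> T" "card S' = r"
  shows "span_on V M S \<subseteq> span_on V M S'"
proof
  fix y assume y: "y \<in> span_on V M S"
  show "y \<in> span_on V M S'"
  proof (rule ccontr)
    assume "y \<notin> span_on V M S'"
    then have y': "y \<notin> S'" "insert y S' \<in> M" using y by (auto simp: span_on_def)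
    have fin: "finite S'" using T S' finite_subset by blast
    have "card S < card (insert y S')" using y' S S' fin by simp
    then obtain v where v: "v \<in> insert y S' - S" "insert v S \<in> M"
      using matroid_augment[OF M S(1) y'(2)] by blast
    have "v \<in> S'" using v y S(1) by (auto simp: span_on_def insert_absorb)
    then have "insert v S \<subseteq> T" "card (insert v S) = card T"
      using v S S' T finite_subset[of S T] by auto
    then have "insert v S = T" using T(1) by (metis card_subset_eq)
    then show False using v T by simp
  qed
qed

text \<open>Each covering set meets the closure in at most \<open>card S\<close> elements; otherwise
  augmentation would produce an element of the closure that is independent of
  \<open>S\<close>.\<close>

lemma card_span_on_le:
  assumes M: "matroid_on V M" and F: "F \<subseteq> M" "finite F" "\<Union>F = V" and S: "S \<in> M"
  shows "card (span_on V M S) \<le> card F * card S"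
proof -
  have fin: "finite V" using matroid_finite[OF M] .
  have *: "card (I \<inter> span_on V M S) \<le> card S" if I: "I \<in> F" for I
  proof (rule ccontr)
    assume "\<not> ?thesis"
    moreover have "I \<inter> span_on V M S \<in> M" using I F(1) matroid_subset[OF M] by blast
    ultimately obtain v where "v \<in> I \<inter> span_on V M S - S" "insert v S \<in> M"
      using matroid_augment[OF M S] by (metis not_le)
    then show False by (auto simp: span_on_def)
  qed
  have "span_on V M S = (\<Union>I\<in>F. I \<inter> span_on V M S)"
    using F(3) by (auto simp: span_on_def)
  then have "card (span_on V M S) \<le> (\<Sum>I\<in>F. card (I \<inter> span_on V M S))"
    using card_UN_le[OF F(2), of "\<lambda>I. I \<inter> span_on V M S"] by simp
  also have "\<dots> \<le> (\<Sum>I\<in>F. card S)" by (intro sum_mono *)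
  finally show ?thesis by simp
qed

text \<open>In the proof, \<open>\<Phi> A\<close> is the part of \<open>\<phi>\<close> living on the bases of the flat \<open>A\<close>.\<close>

lemma sum_cob_sq_dependent_le:
  fixes \<phi> :: "'a set \<Rightarrow> real"
  assumes M: "matroid_on V M" and F: "F \<subseteq> M" "finite F" "\<Union>F = V" and g: "inj_on g V"
    and \<phi>: "\<And>S. \<phi> S \<noteq> 0 \<Longrightarrow> S \<in> M \<and> card S = r"
  shows "(\<Sum>T\<in>Pow V - M. (cob g \<phi> T)\<^sup>2) \<le> (card F * r) * (\<Sum>S\<in>Pow V. (\<phi> S)\<^sup>2)"
proof -
  have fin: "finite V" using matroid_finite[OF M] .
  let ?B = "{S \<in> M. card S = r}"
  let ?sp = "span_on V M"
  have BV: "S \<subseteq> V" "?sp S \<subseteq> V" "finite S" "finite (?sp S)" if "S \<in> M" for S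
    using matroid_carrier[OF M that] fin finite_subset by (auto simp: span_on_def)
  have finB: "finite ?B" by (rule finite_subset[of _ "Pow V"]) (use BV fin in auto)
  define \<Phi> where "\<Phi> A S = (if S \<in> ?B \<and> ?sp S = A then \<phi> S else 0)" for A S
  \<comment> \<open>All facets of \<open>T\<close> in the support of \<open>\<phi>\<close> span one
    flat, and this flat contains \<open>T\<close>, so a single summand accounts for the whole
    coboundary.\<close>
  have pt: "(cob g \<phi> T)\<^sup>2 \<le> (\<Sum>A\<in>?sp ` ?B. if T \<subseteq> A then (cob g (\<Phi> A) T)\<^sup>2 else 0)"
    if T: "T \<in> Pow V - M" for T
  proof (cases "cob g \<phi> T = 0")
    case True
    then show ?thesis by (auto intro!: sum_nonneg)
  next
    case False
    then obtain x where x: "x \<in> T" "\<phi> (T - {x}) \<noteq> 0"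
      unfolding cob_def by (metis (no_types, lifting) mult_zero_right sum.neutral)
    have fT: "finite T" using T fin finite_subset by auto
    have X: "T - {x} \<in> M" "card (T - {x}) = r" using \<phi>[OF x(2)] by auto
    then have cT: "card T = Suc r" using x fT by (metis card_Suc_Diff1)
    let ?A = "?sp (T - {x})"
    have TA: "T \<subseteq> ?A" using T x by (auto simp: span_on_def insert_absorb)
    have "cob g \<phi> T = cob g (\<Phi> ?A) T"
      unfolding cob_def
    proof (intro sum.cong refl)
      fix y assume y: "y \<in> T"
      show "inc g y T * \<phi> (T - {y}) = inc g y T * \<Phi> ?A (T - {y})"
      proof (cases "\<phi> (T - {y}) = 0")
        case False
        then have Y: "T - {y} \<in> M" "card (T - {y}) = r" using \<phi> by auto
        have "?sp (T - {y}) = ?A"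
          using X Y T cT fT by (intro equalityI span_on_subset[OF M fT _ cT]) auto
        then show ?thesis using Y by (simp add: \<Phi>_def)
      qed (simp add: \<Phi>_def)
    qed
    then have "(cob g \<phi> T)\<^sup>2 = (if T \<subseteq> ?A then (cob g (\<Phi> ?A) T)\<^sup>2 else 0)" using TA by simp
    also have "\<dots> \<le> (\<Sum>A\<in>?sp ` ?B. if T \<subseteq> A then (cob g (\<Phi> A) T)\<^sup>2 else 0)"
      by (rule member_le_sum[of ?A "?sp ` ?B"]) (use X finB in auto)
    finally show ?thesis .
  qed
  have flat: "(\<Sum>T\<in>Pow V. if T \<subseteq> A then (cob g (\<Phi> A) T)\<^sup>2 else 0)
      \<le> (card F * r) * (\<Sum>S\<in>Pow V. (\<Phi> A S)\<^sup>2)" if A: "A \<in> ?sp ` ?B" for A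
  proof -
    obtain S where S: "S \<in> ?B" "A = ?sp S" using A by blast
    then have AV: "A \<subseteq> V" "finite A" using BV by auto
    have "(\<Sum>T\<in>Pow V. if T \<subseteq> A then (cob g (\<Phi> A) T)\<^sup>2 else 0) = (\<Sum>T\<in>Pow A. (cob g (\<Phi> A) T)\<^sup>2)"
      using AV fin by (intro sum.mono_neutral_cong_right) auto
    also have "\<dots> \<le> card A * (\<Sum>S\<in>Pow A. (\<Phi> A S)\<^sup>2)"
      by (rule sum_cob_sq_le[OF AV(2)]) (use g AV inj_on_subset in blast)
    also have "\<dots> \<le> (card F * r) * (\<Sum>S\<in>Pow V. (\<Phi> A S)\<^sup>2)"
    proof (rule mult_mono)
      show "real (card A) \<le> real (card F * r)"
        using card_span_on_le[OF M F, of S] S by (metis (lifting) mem_Collect_eq of_nat_le_iff)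
      show "(\<Sum>S\<in>Pow A. (\<Phi> A S)\<^sup>2) \<le> (\<Sum>S\<in>Pow V. (\<Phi> A S)\<^sup>2)"
        using AV fin by (intro sum_mono2) auto
    qed (auto intro: sum_nonneg)
    finally show ?thesis .
  qed
  have "(\<Sum>T\<in>Pow V - M. (cob g \<phi> T)\<^sup>2)
      \<le> (\<Sum>T\<in>Pow V - M. \<Sum>A\<in>?sp ` ?B. if T \<subseteq> A then (cob g (\<Phi> A) T)\<^sup>2 else 0)"
    by (intro sum_mono pt)
  also have "\<dots> \<le> (\<Sum>T\<in>Pow V. \<Sum>A\<in>?sp ` ?B. if T \<subseteq> A then (cob g (\<Phi> A) T)\<^sup>2 else 0)"
    using fin by (intro sum_mono2) (auto intro!: sum_nonneg)
  also have "\<dots> = (\<Sum>A\<in>?sp ` ?B. \<Sum>T\<in>Pow V. if T \<subseteq> A then (cob g (\<Phi> A) T)\<^sup>2 else 0)"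
    by (rule sum.swap)
  also have "\<dots> \<le> (\<Sum>A\<in>?sp ` ?B. (card F * r) * (\<Sum>S\<in>Pow V. (\<Phi> A S)\<^sup>2))"
    by (intro sum_mono flat)
  also have "\<dots> = (card F * r) * (\<Sum>S\<in>Pow V. \<Sum>A\<in>?sp ` ?B. (\<Phi> A S)\<^sup>2)"
    unfolding sum_distrib_left[symmetric] by (subst sum.swap) (rule refl)
  \<comment> \<open>An independent set spans only one flat, so the pieces \<open>\<Phi> A\<close>
    have disjoint supports and their squared norms add up.\<close>
  also have "(\<Sum>S\<in>Pow V. \<Sum>A\<in>?sp ` ?B. (\<Phi> A S)\<^sup>2) = (\<Sum>S\<in>Pow V. (\<phi> S)\<^sup>2)"
  proof (intro sum.cong refl)
    fix S
    show "(\<Sum>A\<in>?sp ` ?B. (\<Phi> A S)\<^sup>2) = (\<phi> S)\<^sup>2"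
    proof (cases "S \<in> ?B")
      case True
      have "(\<Sum>A\<in>?sp ` ?B. (\<Phi> A S)\<^sup>2) = (\<Sum>A\<in>{?sp S}. (\<Phi> A S)\<^sup>2)"
        using True finB by (intro sum.mono_neutral_right) (auto simp: \<Phi>_def)
      then show ?thesis using True by (simp add: \<Phi>_def)
    next
      case False
      then have "\<phi> S = 0" using \<phi>[of S] by blast
      then show ?thesis by (auto simp: \<Phi>_def intro!: sum.neutral)
    qed
  qed
  finally show ?thesis .
qed

section \<open>Acyclicity of the intersection of two matroids\<close>

text \<open>Orthogonal projection by a Gram-Schmidt step: \<open>h\<close> and \<open>k\<close> are
  the residuals of \<open>z\<close> and of the new vector against the old ones, and the component of
  \<open>h\<close> along \<open>k\<close> is removed.\<close>

lemma least_squares_residual: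
  fixes G :: "'i \<Rightarrow> 'b \<Rightarrow> real"
  assumes "finite E" "finite D"
  shows "\<exists>w. \<forall>i\<in>E. (\<Sum>s\<in>D. (z s - (\<Sum>j\<in>E. w j * G j s)) * G i s) = 0"
  using assms(1)
proof (induction E arbitrary: z rule: finite_induct)
  case empty
  then show ?case by simp
next
  case (insert e E)
  obtain u where u: "\<forall>i\<in>E. (\<Sum>s\<in>D. (z s - (\<Sum>j\<in>E. u j * G j s)) * G i s) = 0"
    using insert.IH by blast
  obtain v where v: "\<forall>i\<in>E. (\<Sum>s\<in>D. (G e s - (\<Sum>j\<in>E. v j * G j s)) * G i s) = 0"
    using insert.IH by blast
  define h where "h s = z s - (\<Sum>j\<in>E. u j * G j s)" for s
  define k where "k s = G e s - (\<Sum>j\<in>E. v j * G j s)" for s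
  \<comment> \<open>If \<open>k\<close> vanishes on \<open>D\<close>, the quotient is 0 by the
    convention for division by zero, and orthogonality to \<open>k\<close> is trivial.\<close>
  define t where "t = (\<Sum>s\<in>D. h s * k s) / (\<Sum>s\<in>D. k s * k s)"
  define w where "w = (\<lambda>j. u j - t * v j)(e := t)"
  have res: "z s - (\<Sum>j\<in>insert e E. w j * G j s) = h s - t * k s" for s
  proof -
    have "(\<Sum>j\<in>E. w j * G j s) = (\<Sum>j\<in>E. u j * G j s - t * (v j * G j s))"
      using insert.hyps by (intro sum.cong refl) (auto simp: w_def algebra_simps)
    then show ?thesis
      using insert.hyps
      by (simp add: w_def h_def k_def sum_subtractf sum_distrib_left algebra_simps)
  qed
  have orth: "(\<Sum>s\<in>D. (h s - t * k s) * G i s) = 0" if "i \<in> E" for i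
  proof -
    have "(\<Sum>s\<in>D. (h s - t * k s) * G i s) = (\<Sum>s\<in>D. h s * G i s) - t * (\<Sum>s\<in>D. k s * G i s)"
      by (simp add: algebra_simps sum_subtractf sum_distrib_left)
    then show ?thesis using u v that by (simp add: h_def k_def)
  qed
  have orthk: "(\<Sum>s\<in>D. (h s - t * k s) * k s) = 0"
  proof (cases "(\<Sum>s\<in>D. k s * k s) = 0")
    case True
    then have "\<forall>s\<in>D. k s = 0" using assms(2) by (simp add: sum_nonneg_eq_0_iff)
    then show ?thesis by simp
  next
    case False
    have "(\<Sum>s\<in>D. (h s - t * k s) * k s) = (\<Sum>s\<in>D. h s * k s) - t * (\<Sum>s\<in>D. k s * k s)"
      by (simp add: algebra_simps sum_subtractf sum_distrib_left)
    then show ?thesis using False by (simp add: t_def)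
  qed
  \<comment> \<open>The new vector is \<open>k\<close> plus a combination of old ones, and the
    residual is orthogonal to each of these.\<close>
  have "(\<Sum>s\<in>D. (h s - t * k s) * G e s) =
      (\<Sum>s\<in>D. (h s - t * k s) * k s + (\<Sum>j\<in>E. v j * ((h s - t * k s) * G j s)))"
  proof (intro sum.cong refl)
    fix s
    have "(\<Sum>j\<in>E. v j * ((h s - t * k s) * G j s)) = (h s - t * k s) * (\<Sum>j\<in>E. v j * G j s)"
      by (simp add: sum_distrib_left mult_ac)
    moreover have "G e s = k s + (\<Sum>j\<in>E. v j * G j s)" by (simp add: k_def)
    ultimately show "(h s - t * k s) * G e s =
        (h s - t * k s) * k s + (\<Sum>j\<in>E. v j * ((h s - t * k s) * G j s))"
      by (simp add: distrib_left)
  qed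
  also have "\<dots> = (\<Sum>s\<in>D. (h s - t * k s) * k s)
      + (\<Sum>j\<in>E. v j * (\<Sum>s\<in>D. (h s - t * k s) * G j s))"
    unfolding sum.distrib sum_distrib_left by (subst (2) sum.swap) (rule refl)
  also have "\<dots> = 0" using orth orthk by simp
  finally have "\<forall>i\<in>insert e E. (\<Sum>s\<in>D. (h s - t * k s) * G i s) = 0" using orth by simp
  then show ?case unfolding res[symmetric] by blast
qed

text \<open>A Hodge argument: removing from \<open>z\<close> its projection onto the boundaries
  leaves a harmonic \<open>h\<close>. Its energy is \<open>card V\<close> times its squared norm,
  but the bounds for the two matroids allow only \<open>(card F + card H) * r\<close> times that
  norm, so \<open>h\<close> is zero.\<close>

lemma matroid_intersection_acyclic:
  fixes z :: "'a set \<Rightarrow> real"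
  assumes M: "matroid_on V M" and F: "F \<subseteq> M" "finite F" "\<Union>F = V"
    and N: "matroid_on V N" and H: "H \<subseteq> N" "finite H" "\<Union>H = V"
    and g: "inj_on g V" and big: "(card F + card H) * r < card V"
    and z: "\<And>S. z S \<noteq> 0 \<Longrightarrow> S \<in> M \<inter> N \<and> card S = r"
    and cyc: "\<And>S. bd g V z S = 0"
  shows "\<exists>w. (\<forall>S. w S \<noteq> 0 \<longrightarrow> S \<in> M \<inter> N \<and> card S = Suc r) \<and> (\<forall>S. bd g V w S = z S)"
proof -
  have fin: "finite V" using matroid_finite[OF M] .
  define E where "E = {T \<in> M \<inter> N. card T = Suc r}"
  have EV: "T \<subseteq> V" "finite T" if "T \<in> M" for T
    using matroid_carrier[OF M that] fin finite_subset by auto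
  have finE: "finite E" by (rule finite_subset[of _ "Pow V"]) (use EV fin E_def in auto)
  \<comment> \<open>Indicators of single faces; the boundaries of those in \<open>E\<close> span the
    boundaries onto which \<open>z\<close> is projected.\<close>
  let ?\<delta> = "\<lambda>T S. if S = T then 1 else (0::real)"
  obtain w0 where w0: "\<And>T. T \<in> E \<Longrightarrow>
      (\<Sum>S\<in>Pow V. (z S - (\<Sum>T'\<in>E. w0 T' * bd g V (?\<delta> T') S)) * bd g V (?\<delta> T) S) = 0"
    using least_squares_residual[OF finE, of "Pow V" z "\<lambda>T. bd g V (?\<delta> T)"] fin by auto
  define w where "w S = (if S \<in> E then w0 S else 0)" for S
  define h where "h S = z S - bd g V w S" for S
  have bdw: "(\<Sum>T\<in>E. w0 T * bd g V (?\<delta> T) S) = bd g V w S" for S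
  proof -
    have "(\<Sum>T\<in>E. w0 T * bd g V (?\<delta> T) S)
        = (\<Sum>x\<in>V - S. \<Sum>T\<in>E. w0 T * (inc g x S * ?\<delta> T (insert x S)))"
      unfolding bd_def sum_distrib_left by (rule sum.swap)
    also have "\<dots> = bd g V w S"
      unfolding bd_def
    proof (intro sum.cong refl)
      fix x
      have "(\<Sum>T\<in>E. w0 T * (inc g x S * ?\<delta> T (insert x S)))
          = (\<Sum>T\<in>E. if insert x S = T then w0 T * inc g x S else 0)"
        by (intro sum.cong refl) auto
      then show "(\<Sum>T\<in>E. w0 T * (inc g x S * ?\<delta> T (insert x S))) = inc g x S * w (insert x S)"
        using finE by (simp add: w_def sum.delta')
    qed
    finally show ?thesis .
  qed
  \<comment> \<open>By adjointness, orthogonality of \<open>h\<close> to the boundary of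
    \<open>T\<close> says that its coboundary vanishes at \<open>T\<close>.\<close>
  have cobh_E: "cob g h T = 0" if T: "T \<in> E" for T
  proof -
    have "0 = (\<Sum>S\<in>Pow V. h S * bd g V (?\<delta> T) S)" using w0[OF T] by (simp add: bdw h_def)
    also have "\<dots> = (\<Sum>S\<in>Pow V. cob g h S * ?\<delta> T S)" by (rule sum_cob_mult[OF fin, symmetric])
    also have "\<dots> = (\<Sum>S\<in>Pow V. if T = S then cob g h S else 0)"
      by (intro sum.cong refl) auto
    also have "\<dots> = cob g h T" using T EV fin by (simp add: E_def sum.delta)
    finally show ?thesis by simp
  qed
  have h: "S \<in> M \<inter> N \<and> card S = r" if "h S \<noteq> 0" for S
  proof (cases "z S = 0")
    case True
    then have "bd g V w S \<noteq> 0" using that by (simp add: h_def)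
    then obtain x where x: "x \<in> V - S" "w (insert x S) \<noteq> 0"
      unfolding bd_def by (metis (no_types, lifting) mult_zero_right sum.neutral)
    then have xE: "insert x S \<in> E" by (metis w_def)
    then have "S \<in> M \<inter> N"
      using matroid_subset[OF M, of _ S] matroid_subset[OF N, of _ S] by (auto simp: E_def)
    moreover have "card S = r"
      using xE x EV(2)[of S] \<open>S \<in> M \<inter> N\<close> by (auto simp: E_def)
    ultimately show ?thesis by simp
  qed (use z in blast)
  have bdh: "bd g V h S = 0" if S: "S \<in> Pow V" for S
  proof -
    have "bd g V h S = bd g V z S - bd g V (bd g V w) S"
      by (simp add: bd_def h_def sum_subtractf algebra_simps)
    then show ?thesis using cyc bd_bd[OF fin g, of S w] S by simp
  qed
  have cobh: "cob g h T = 0" if T: "T \<in> M \<inter> N" for T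
  proof (cases "card T = Suc r")
    case True
    then show ?thesis using T cobh_E by (simp add: E_def)
  next
    case False
    have "h (T - {x}) = 0" if "x \<in> T" for x
    proof (rule ccontr)
      assume "h (T - {x}) \<noteq> 0"
      then have "card (T - {x}) = r" using h by blast
      then have "card T = Suc r" using that EV(2) T by (metis IntD1 card_Suc_Diff1)
      then show False using False by simp
    qed
    then show ?thesis by (simp add: cob_def)
  qed
  let ?n = "\<Sum>S\<in>Pow V. (h S)\<^sup>2"
  \<comment> \<open>Since \<open>h\<close> is a cycle, the simplex identity leaves only coboundary
    energy, and this sits on sets dependent in \<open>M\<close> or in \<open>N\<close>.\<close>
  have "card V * ?n = (\<Sum>T\<in>Pow V. (cob g h T)\<^sup>2)"
    using sum_cob_sq_plus_sum_bd_sq[OF fin g, of h] bdh by simp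
  also have "\<dots> = (\<Sum>T\<in>(Pow V - M) \<union> (Pow V - N). (cob g h T)\<^sup>2)"
    using fin cobh by (intro sum.mono_neutral_right) auto
  also have "\<dots> \<le> (\<Sum>T\<in>Pow V - M. (cob g h T)\<^sup>2) + (\<Sum>T\<in>Pow V - N. (cob g h T)\<^sup>2)"
    using fin by (subst sum_Un) (auto intro: sum_nonneg)
  also have "\<dots> \<le> (card F * r) * ?n + (card H * r) * ?n"
    by (intro add_mono sum_cob_sq_dependent_le[OF M F g] sum_cob_sq_dependent_le[OF N H g])
      (use h in auto)
  finally have "card V * ?n \<le> ((card F + card H) * r) * ?n" by (simp add: algebra_simps)
  moreover have "?n \<ge> 0" by (rule sum_nonneg) simp
  moreover have "real ((card F + card H) * r) < real (card V)"
    using big by (simp only: of_nat_less_iff)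
  ultimately have "?n = 0" by (meson less_eq_real_def mult_strict_right_mono not_less)
  then have "h S = 0" if "S \<in> Pow V" for S
    using that fin by (simp add: sum_nonneg_eq_0_iff)
  then have "h S = 0" for S
    using h[of S] EV(1)[of S] by (cases "S \<in> Pow V") auto
  then have "bd g V w S = z S" for S by (simp add: h_def)
  moreover have "S \<in> M \<inter> N \<and> card S = Suc r" if "w S \<noteq> 0" for S
    using that unfolding w_def E_def by (auto split: if_splits)
  ultimately show ?thesis by blast
qed

section \<open>Rainbow faces\<close>

definition transversals :: "('a \<Rightarrow> 'v) \<Rightarrow> 'v set \<Rightarrow> 'a set set" where
  "transversals p X = {S. inj_on p S \<and> p ` S = X}"

lemma cob_of_bool:
  assumes "finite T"
  shows "cob g (\<lambda>S. of_bool (S \<in> R)) T = (\<Sum>x\<in>{x \<in> T. T - {x} \<in> R}. inc g x T)"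
proof -
  have "cob g (\<lambda>S. of_bool (S \<in> R)) T = (\<Sum>x\<in>T. if T - {x} \<in> R then inc g x T else 0)"
    unfolding cob_def by (intro sum.cong) auto
  then show ?thesis using assms by (simp add: sum.inter_filter)
qed

text \<open>
  If \<open>T\<close> is not a transversal but contains one of \<open>X - {v}\<close> as a facet, it has exactly two such
  facets, obtained by deleting one of two elements in the same fibre of \<open>p\<close>. As \<open>p\<close> is monotone with
  respect to the orders given by \<open>g\<close> and \<open>a\<close>, these elements are adjacent in \<open>T\<close> and the signs cancel.
\<close>

lemma cob_transversal_indicator:
  assumes g: "inj_on g T" and T: "finite T" "p ` T \<subseteq> X" and v: "v \<in> X" and a: "inj_on a X"
    and mono: "\<And>w w'. w \<in> T \<Longrightarrow> w' \<in> T \<Longrightarrow> g w < g w' \<Longrightarrow> a (p w) \<le> a (p w')"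
  shows "cob g (\<lambda>S. of_bool (S \<in> transversals p (X - {v}))) T
      = inc a v X * of_bool (T \<in> transversals p X)"
proof -
  let ?R = "transversals p (X - {v})"
  \<comment> \<open>Between different fibres the weak monotonicity becomes an equivalence, because
    \<open>a\<close> separates the points of \<open>X\<close>.\<close>
  have lt: "g y < g w \<longleftrightarrow> a (p y) < a (p w)" if "y \<in> T" "w \<in> T" "p y \<noteq> p w" for y w
  proof -
    have "a (p y) \<noteq> a (p w)" using that T(2) a by (auto dest: inj_onD)
    moreover have "g y \<noteq> g w" using that g by (auto dest: inj_onD)
    ultimately show ?thesis using mono[of y w] mono[of w y] that by (meson leD le_less linorder_neqE_nat)
  qed
  show ?thesis
  proof (cases "\<exists>x\<in>T. T - {x} \<in> ?R")
    case False
    have "T \<notin> transversals p X"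
    proof
      assume "T \<in> transversals p X"
      then have iT: "inj_on p T" "p ` T = X" by (auto simp: transversals_def)
      then obtain x where x: "x \<in> T" "p x = v" using v by blast
      have "T - {x} \<in> ?R" using iT x by (auto simp: transversals_def inj_on_def)
      then show False using False x by blast
    qed
    then show ?thesis using False by (auto simp: cob_def intro!: sum.neutral)
  next
    case True
    then obtain x where x: "x \<in> T" "T - {x} \<in> ?R" by blast
    then have i: "inj_on p (T - {x})" "p ` (T - {x}) = X - {v}" by (auto simp: transversals_def)
    have pxX: "p x \<in> X" using x T by auto
    show ?thesis
    proof (cases "p x = v")
      case True
      have iT: "inj_on p T" "p ` T = X"
      proof -
        have "T = insert x (T - {x})" using x by auto
        then show "inj_on p T" "p ` T = X"
          using i True v by (metis Diff_idemp Diff_iff inj_on_insert singletonI,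
              metis image_insert insert_Diff)
      qed
      have "{y \<in> T. T - {y} \<in> ?R} = {x}"
      proof -
        have "y = x" if "y \<in> T" "T - {y} \<in> ?R" for y
        proof (rule ccontr)
          assume "y \<noteq> x"
          then have "v \<in> p ` (T - {y})" using x True by auto
          then show False using that by (auto simp: transversals_def)
        qed
        then show ?thesis using x by blast
      qed
      then have "cob g (\<lambda>S. of_bool (S \<in> ?R)) T = inc g x T"
        using T(1) by (simp add: cob_of_bool)
      \<comment> \<open>Here \<open>T\<close> is a transversal, and \<open>p\<close> carries the
        predecessors of \<open>x\<close> bijectively to those of \<open>v\<close>, so the signs
        agree.\<close>
      also have "card {y \<in> T. g y < g x} = card {u \<in> X. a u < a v}"
      proof (rule bij_betw_same_card[of p])
        have "p ` {y \<in> T. g y < g x} = {u \<in> X. a u < a v}"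
        proof (intro equalityI subsetI)
          fix u assume "u \<in> p ` {y \<in> T. g y < g x}"
          then obtain y where y: "y \<in> T" "g y < g x" "u = p y" by blast
          then have "p y \<noteq> p x" using iT x by (auto dest: inj_onD)
          then show "u \<in> {u \<in> X. a u < a v}" using lt[of y x] y x iT True by auto
        next
          fix u assume u: "u \<in> {u \<in> X. a u < a v}"
          then obtain y where y: "y \<in> T" "u = p y" using iT by blast
          then have "p y \<noteq> p x" using u True by auto
          then show "u \<in> p ` {y \<in> T. g y < g x}" using lt[of y x] y x u True by auto
        qed
        then show "bij_betw p {y \<in> T. g y < g x} {u \<in> X. a u < a v}"
          using iT by (auto simp: bij_betw_def inj_on_def)
      qed
      then have "inc g x T = inc a v X" by (simp add: inc_def)
      finally show ?thesis using iT by (simp add: transversals_def)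
    next
      case False
      \<comment> \<open>The facet \<open>T - {x}\<close> already meets the fibre of
        \<open>x\<close>, which yields the second element \<open>x'\<close>.\<close>
      then have "p x \<in> p ` (T - {x})" using i pxX by auto
      then obtain x' where "p x = p x'" "x' \<in> T - {x}" by (rule imageE)
      then have x': "x' \<in> T" "x' \<noteq> x" "p x' = p x" by simp_all
      define Q where "Q = T - {x, x'}"
      have Q: "finite Q" "x \<notin> Q" "x' \<notin> Q" "T = insert x (insert x' Q)" "T - {x} = insert x' Q"
        "T - {x'} = insert x Q"
        using T x x' by (auto simp: Q_def)
      have pQ: "p x \<notin> p ` Q"
        using i(1) x' Q by (auto simp: inj_on_def)
      have "T - {x'} \<in> ?R"
        using x(2) x' pQ Q(2,3) unfolding Q(5,6) by (auto simp: transversals_def)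
      moreover have "T - {y} \<notin> ?R" if "y \<in> T" "y \<noteq> x" "y \<noteq> x'" for y
      proof -
        have "x \<in> T - {y}" "x' \<in> T - {y}" using x x' that by auto
        then have "\<not> inj_on p (T - {y})" using x'(2,3) unfolding inj_on_def by blast
        then show ?thesis by (simp add: transversals_def)
      qed
      ultimately have "{y \<in> T. T - {y} \<in> ?R} = {x, x'}" using x x' by blast
      then have "cob g (\<lambda>S. of_bool (S \<in> ?R)) T = inc g x T + inc g x' T"
        using T(1) x'(2) by (simp add: cob_of_bool)
      also have "\<dots> = 0"
      proof -
        \<comment> \<open>No element of \<open>Q\<close> shares the fibre of \<open>x\<close> and
          \<open>x'\<close>, so \<open>lt\<close> gives both the same predecessors in
          \<open>Q\<close>. The opposite sign comes from comparing \<open>x\<close> with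
          \<open>x'\<close>.\<close>
        have "inc g x Q = inc g x' Q"
        proof -
          have "g y < g x \<longleftrightarrow> g y < g x'" if "y \<in> Q" for y
          proof -
            have "p y \<noteq> p x" using pQ that by (metis imageI)
            moreover have "y \<in> T" using that by (simp add: Q_def)
            ultimately show ?thesis using lt[of y x] lt[of y x'] x(1) x'(1,3) by simp
          qed
          then have "{y \<in> Q. g y < g x} = {y \<in> Q. g y < g x'}" by blast
          then show ?thesis by (simp add: inc_def)
        qed
        moreover have "inc g x T = inc g x (insert x' Q)" using Q by simp
        moreover have "inc g x' T = inc g x' (insert x Q)" using Q by (simp add: insert_commute)
        moreover have "g x \<noteq> g x'" using g x x' by (auto dest: inj_onD)
        ultimately show ?thesis using Q by (simp add: inc_insert)
      qed
      also have "T \<notin> transversals p X"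
        using x x' by (auto simp: transversals_def inj_on_def)
      then have "0 = inc a v X * of_bool (T \<in> transversals p X)" by simp
      finally show ?thesis .
    qed
  qed
qed

text \<open>Vanishing of reduced homology in dimension \<open>card X - 2\<close> for the part of
  \<open>C\<close> over \<open>X\<close>, as the topological Hall theorem requires. The empty face
  counts: for a singleton \<open>X\<close> the condition asks for a vertex over
  \<open>X\<close>.\<close>

definition acyclic_over ::
    "('a \<Rightarrow> nat) \<Rightarrow> 'a set \<Rightarrow> 'a set set \<Rightarrow> ('a \<Rightarrow> 'v) \<Rightarrow> 'v set \<Rightarrow> bool" where
  "acyclic_over g W C p X \<longleftrightarrow> (\<forall>z.
     (\<forall>S. z S \<noteq> 0 \<longrightarrow> S \<in> C \<and> p ` S \<subseteq> X \<and> Suc (card S) = card X) \<longrightarrow>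
     (\<forall>S. bd g W z S = 0) \<longrightarrow>
     (\<exists>w. (\<forall>S. w S \<noteq> 0 \<longrightarrow> S \<in> C \<and> p ` S \<subseteq> X \<and> card S = card X) \<and>
          (\<forall>S. bd g W w S = z S)))"

text \<open>
  The chains \<open>c X\<close> are the images of the faces \<open>X\<close> under a chain map from the simplex on \<open>V\<close>, built by
  filling cycles in increasing dimension.
\<close>

lemma exists_chain_map:
  assumes V: "finite V" "inj_on a V" and C: "{} \<in> C"
    and acyclic: "\<forall>X\<subseteq>V. X \<noteq> {} \<longrightarrow> acyclic_over g W C p X"
  obtains c where "c {} {} = 1"
    and "\<And>X S. X \<subseteq> V \<Longrightarrow> c X S \<noteq> 0 \<Longrightarrow> S \<in> C \<and> p ` S \<subseteq> X \<and> card S = card X"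
    and "\<And>X S. X \<subseteq> V \<Longrightarrow> X \<noteq> {} \<Longrightarrow>
        bd g W (c X) S = (\<Sum>v\<in>X. inc a v X * c (X - {v}) S)"
proof -
  let ?supp = "\<lambda>c X. \<forall>S. c S \<noteq> (0::real) \<longrightarrow> S \<in> C \<and> p ` S \<subseteq> X \<and> card S = card X"
  let ?bdy = "\<lambda>c X d. \<forall>S. bd g W d S = (\<Sum>v\<in>X. inc a v X * c (X - {v}) S)"
  let ?ok = "\<lambda>n c. c {} = (\<lambda>S. of_bool (S = {})) \<and>
      (\<forall>X\<subseteq>V. card X \<le> n \<longrightarrow> ?supp (c X) X \<and> (X \<noteq> {} \<longrightarrow> ?bdy c X (c X)))"
  have fX: "finite X" if "X \<subseteq> V" for X using V that finite_subset by blast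
  have ex: "\<exists>c. ?ok n c" for n
  proof (induction n)
    case 0
    show ?case
      by (rule exI[of _ "\<lambda>_ S. of_bool (S = {})"]) (use C fX in auto)
  next
    case (Suc n)
    obtain c where c: "?ok n c" using Suc.IH by (rule exE)
    then have c0: "c {} = (\<lambda>S. of_bool (S = {}))"
      and supp: "\<And>X. X \<subseteq> V \<Longrightarrow> card X \<le> n \<Longrightarrow> ?supp (c X) X"
      and bdc: "\<And>X. X \<subseteq> V \<Longrightarrow> card X \<le> n \<Longrightarrow> X \<noteq> {} \<Longrightarrow> ?bdy c X (c X)"
      by blast+
    have ex_w: "\<exists>w. ?supp w X \<and> ?bdy c X w" if X: "X \<subseteq> V" "card X = Suc n" for X
    proof -
      have ne: "X \<noteq> {}" using X by auto
      have cX: "card (X - {v}) = n" if "v \<in> X" for v using X that fX by simp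
      define z where "z S = (\<Sum>v\<in>X. inc a v X * c (X - {v}) S)" for S
      have "S \<in> C \<and> p ` S \<subseteq> X \<and> Suc (card S) = card X" if z: "z S \<noteq> 0" for S
      proof -
        obtain v where v: "v \<in> X" "c (X - {v}) S \<noteq> 0"
          using z unfolding z_def by (metis (no_types, lifting) mult_zero_right sum.neutral)
        then have "S \<in> C" "p ` S \<subseteq> X - {v}" "card S = card (X - {v})"
          using supp[of "X - {v}"] X cX[of v] by auto
        then show ?thesis using v cX X by auto
      qed
      moreover have "bd g W z S = 0" for S
      proof (cases "n = 0")
        \<comment> \<open>The boundary formula says nothing about \<open>c {}\<close>, so this case
          is separate: \<open>z\<close> is a multiple of the empty face, whose boundary is
          zero.\<close>
        case True
        then obtain v where "X = {v}" using X by (metis One_nat_def card_1_singletonE)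
        then show ?thesis using c0 by (auto simp: bd_def z_def intro!: sum.neutral)
      next
        case False
        let ?h = "\<lambda>v u. if u = v then 0 else inc a v X * inc a u (X - {v}) * c (X - {v} - {u}) S"
        have "bd g W z S = (\<Sum>v\<in>X. inc a v X * bd g W (c (X - {v})) S)"
          unfolding bd_def z_def sum_distrib_left by (subst sum.swap) (simp add: mult_ac)
        also have "\<dots> = (\<Sum>v\<in>X. \<Sum>u\<in>X. ?h v u)"
        proof (intro sum.cong refl)
          fix v assume v: "v \<in> X"
          have "X - {v} \<noteq> {}" using cX[OF v] False by (metis card.empty)
          then have "bd g W (c (X - {v})) S
              = (\<Sum>u\<in>X - {v}. inc a u (X - {v}) * c (X - {v} - {u}) S)"
            using bdc[of "X - {v}"] X cX[OF v] by auto
          then have "inc a v X * bd g W (c (X - {v})) S = (\<Sum>u\<in>X - {v}. ?h v u)"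
            by (auto simp: sum_distrib_left mult.assoc intro!: sum.cong)
          also have "\<dots> = (\<Sum>u\<in>X. ?h v u)"
            using fX[OF X(1)] by (intro sum.mono_neutral_left) auto
          finally show "inc a v X * bd g W (c (X - {v})) S = (\<Sum>u\<in>X. ?h v u)" .
        qed
        also have "\<dots> = 0"
        proof (rule sum_antisym_zero)
          fix v u assume vu: "v \<in> X" "u \<in> X"
          show "?h v u = - ?h u v"
          proof (cases "u = v")
            case False
            define Q where "Q = X - {u, v}"
            have Q: "finite Q" "u \<notin> Q" "v \<notin> Q" "X = insert v (insert u Q)"
              "X - {v} = insert u Q" "X - {u} = insert v Q"
              using vu False fX[OF X(1)] by (auto simp: Q_def)
            have "inc a v X = inc a v (insert u Q)" "inc a u X = inc a u (insert v Q)"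
              using Q(4) by (metis inc_insert_self) (metis Q(4) inc_insert_self insert_commute)
            moreover have "X - {v} - {u} = X - {u} - {v}" by auto
            moreover have "a u \<noteq> a v" using vu X V False by (auto dest: inj_onD)
            ultimately show ?thesis
              using inc_swap[of Q u v a] Q(1,2,3) False unfolding Q(5,6) by (simp add: mult_ac)
          qed simp
        qed
        finally show ?thesis .
      qed
      ultimately show ?thesis
        using acyclic X(1) ne unfolding acyclic_over_def z_def[symmetric] by simp
    qed
    define w where "w X = (SOME w. ?supp w X \<and> ?bdy c X w)" for X
    have w: "?supp (w X) X \<and> ?bdy c X (w X)" if "X \<subseteq> V" "card X = Suc n" for X
      unfolding w_def using ex_w[OF that] by (rule someI_ex)
    \<comment> \<open>Chains on smaller sets are kept, so the boundary formula obtained with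
      \<open>c\<close> remains valid for \<open>c'\<close>.\<close>
    define c' where "c' X = (if card X = Suc n then w X else c X)" for X
    have low: "c' (X - {v}) = c (X - {v})" if "X \<subseteq> V" "card X \<le> Suc n" "v \<in> X" for X v
      using that fX[OF that(1)] by (auto simp: c'_def card_Diff_singleton)
    have "?ok (Suc n) c'"
    proof (intro conjI allI impI)
      show "c' {} = (\<lambda>S. of_bool (S = {}))" using c0 by (simp add: c'_def)
    next
      fix X S assume X: "X \<subseteq> V" "card X \<le> Suc n" and S: "c' X S \<noteq> 0"
      show "S \<in> C" "p ` S \<subseteq> X" "card S = card X"
        using X S w[of X] supp[of X] by (auto simp: c'_def split: if_splits)
    next
      fix X S assume X: "X \<subseteq> V" "card X \<le> Suc n" "X \<noteq> {}"
      have "bd g W (c' X) S = (\<Sum>v\<in>X. inc a v X * c (X - {v}) S)"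
        using X w[of X] bdc[of X] by (auto simp: c'_def)
      then show "bd g W (c' X) S = (\<Sum>v\<in>X. inc a v X * c' (X - {v}) S)"
        using low[OF X(1,2)] by simp
    qed
    then show ?case by (rule exI[of _ c'])
  qed
  obtain c where c: "?ok (card V) c" using ex[of "card V"] by (rule exE)
  show thesis
    by (rule that[of c]) (use c card_mono[OF V(1)] in auto)
qed

text \<open>
  The signed count \<open>R X\<close> of transversals of \<open>X\<close> in \<open>c X\<close> does not change when a vertex is removed from
  \<open>X\<close>, as in Sperner's lemma, and equals 1 for the empty set.
\<close>

lemma exists_rainbow_face:
  fixes a :: "'v \<Rightarrow> nat" and p :: "'w \<Rightarrow> 'v"
  assumes W: "finite W" "inj_on g W"
    and V: "finite V" "inj_on a V" and C: "{} \<in> C"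
    and mono: "\<And>w w'. w \<in> W \<Longrightarrow> w' \<in> W \<Longrightarrow> g w < g w' \<Longrightarrow> a (p w) \<le> a (p w')"
    and acyclic: "\<forall>X\<subseteq>V. X \<noteq> {} \<longrightarrow> acyclic_over g W C p X"
  shows "\<exists>S\<in>C. inj_on p S \<and> p ` S = V"
proof -
  obtain c where c0: "c {} {} = 1"
    and supp: "\<And>X S. X \<subseteq> V \<Longrightarrow> c X S \<noteq> 0 \<Longrightarrow> S \<in> C \<and> p ` S \<subseteq> X \<and> card S = card X"
    and bdc: "\<And>X S. X \<subseteq> V \<Longrightarrow> X \<noteq> {} \<Longrightarrow>
        bd g W (c X) S = (\<Sum>v\<in>X. inc a v X * c (X - {v}) S)"
    by (rule exists_chain_map[OF V C acyclic]) (rule that, assumption, blast+)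
  let ?\<rho> = "\<lambda>X S. of_bool (S \<in> transversals p X) :: real"
  let ?R = "\<lambda>X. \<Sum>S\<in>Pow W. ?\<rho> X S * c X S"
  have step: "?R X = ?R (X - {v})" if X: "X \<subseteq> V" "v \<in> X" for X v
  proof -
    have fX: "finite X" using X V finite_subset by blast
    \<comment> \<open>One pairing is evaluated twice: first by moving the boundary onto the
      indicator, then by the boundary formula for \<open>c X\<close>.\<close>
    have "(\<Sum>S\<in>Pow W. ?\<rho> (X - {v}) S * bd g W (c X) S)
        = (\<Sum>T\<in>Pow W. cob g (?\<rho> (X - {v})) T * c X T)"
      by (rule sum_cob_mult[OF W(1), symmetric])
    also have "\<dots> = (\<Sum>T\<in>Pow W. inc a v X * (?\<rho> X T * c X T))"
    proof (intro sum.cong refl)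
      fix T assume T: "T \<in> Pow W"
      show "cob g (?\<rho> (X - {v})) T * c X T = inc a v X * (?\<rho> X T * c X T)"
      proof (cases "c X T = 0")
        case False
        have "cob g (?\<rho> (X - {v})) T = inc a v X * ?\<rho> X T"
        proof (rule cob_transversal_indicator)
          show "inj_on g T" "inj_on a X" using T W V X inj_on_subset by blast+
          show "finite T" using T W finite_subset by blast
          show "p ` T \<subseteq> X" using supp[OF X(1) False] by blast
          show "a (p w) \<le> a (p w')" if "w \<in> T" "w' \<in> T" "g w < g w'" for w w'
            using that T by (intro mono) auto
        qed (fact X(2))
        then show ?thesis by simp
      qed simp
    qed
    also have "\<dots> = inc a v X * ?R X" by (simp add: sum_distrib_left)
    finally have 1: "(\<Sum>S\<in>Pow W. ?\<rho> (X - {v}) S * bd g W (c X) S) = inc a v X * ?R X" .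
    have "(\<Sum>S\<in>Pow W. ?\<rho> (X - {v}) S * bd g W (c X) S)
        = (\<Sum>S\<in>Pow W. inc a v X * (?\<rho> (X - {v}) S * c (X - {v}) S))"
    proof (intro sum.cong refl)
      fix S
      show "?\<rho> (X - {v}) S * bd g W (c X) S = inc a v X * (?\<rho> (X - {v}) S * c (X - {v}) S)"
      proof (cases "S \<in> transversals p (X - {v})")
        case True
        \<comment> \<open>A transversal of \<open>X - {v}\<close> meets the fibre over
          \<open>u\<close>, which the support of \<open>c (X - {u})\<close> avoids.\<close>
        have "c (X - {u}) S = 0" if "u \<in> X" "u \<noteq> v" for u
        proof (rule ccontr)
          assume "c (X - {u}) S \<noteq> 0"
          then have "p ` S \<subseteq> X - {u}" using supp[of "X - {u}"] X by blast
          then show False using True that by (auto simp: transversals_def)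
        qed
        then have "(\<Sum>u\<in>X. inc a u X * c (X - {u}) S) = (\<Sum>u\<in>{v}. inc a u X * c (X - {u}) S)"
          using fX X by (intro sum.mono_neutral_right) auto
        then show ?thesis using bdc[of X S] X by auto
      qed simp
    qed
    also have "\<dots> = inc a v X * ?R (X - {v})" by (simp add: sum_distrib_left)
    finally show ?thesis using 1 by simp
  qed
  have "?R X = 1" if "finite X" "X \<subseteq> V" for X
    using that
  proof (induction X rule: finite_induct)
    case empty
    have "?R {} = (\<Sum>S\<in>Pow W. if S = {} then 1 else 0)"
      using c0 by (intro sum.cong refl) (auto simp: transversals_def)
    then show ?case using W by simp
  next
    case (insert v X)
    then show ?case using step[of "insert v X" v] by simp
  qed
  then have "?R V \<noteq> 0" using V by simp
  then obtain S where "S \<in> Pow W" "?\<rho> V S * c V S \<noteq> 0" by (meson sum.neutral)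
  then show ?thesis using supp[of V S] by (auto simp: transversals_def)
qed

section \<open>List colourings\<close>

text \<open>The direct sum of copies of \<open>M\<close>, one per colour, restricted to the pairs in
  \<open>Y\<close>.\<close>

definition layered :: "('a \<times> 'c) set \<Rightarrow> 'a set set \<Rightarrow> ('a \<times> 'c) set set" where
  "layered Y M = {S. S \<subseteq> Y \<and> (\<forall>c. {v. (v, c) \<in> S} \<in> M)}"

text \<open>Cardinalities add up over the colours, so a larger set is larger in some layer, and
  augmentation is done there.\<close>

lemma matroid_layered:
  fixes Y :: "('a \<times> 'c) set"
  assumes M: "matroid_on V M" and Y: "finite Y" "fst ` Y \<subseteq> V"
  shows "matroid_on Y (layered Y M)"
  unfolding matroid_on_def complex_on_def
proof (intro conjI ballI allI impI)
  have cM: "complex_on V M" using M by (simp add: matroid_on_def)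
  note M0 = complex_on_empty[OF cM]
  show "finite Y" by fact
  show "layered Y M \<noteq> {}" using M0 by (auto simp: layered_def intro!: exI[of _ "{}"])
  show "layered Y M \<subseteq> Pow Y" by (auto simp: layered_def)
  show "T \<in> layered Y M" if "S \<in> layered Y M" "T \<subseteq> S" for S T
  proof -
    have "{v. (v, c) \<in> T} \<in> M" for c
      by (rule matroid_subset[OF M, of "{v. (v, c) \<in> S}"]) (use that in \<open>auto simp: layered_def\<close>)
    then show ?thesis using that by (auto simp: layered_def)
  qed
  show "\<exists>S\<in>layered Y M. y \<in> S" if y: "y \<in> Y" for y
  proof (rule bexI[of _ "{y}"])
    have "{v. (v, c) \<in> {y}} \<in> M" for c
    proof (cases "c = snd y")
      case True
      then have "{v. (v, c) \<in> {y}} = {fst y}" by (auto simp: prod_eq_iff)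
      moreover have "fst y \<in> V" using y Y by auto
      ultimately show ?thesis using complex_on_singleton[OF cM] by metis
    next
      case False
      then have "{v. (v, c) \<in> {y}} = {}" by auto
      then show ?thesis using M0 by metis
    qed
    then show "{y} \<in> layered Y M" using y by (simp add: layered_def)
  qed simp
  fix S T assume S: "S \<in> layered Y M" and T: "T \<in> layered Y M" and less: "card S < card T"
  have fin: "finite S" "finite T" using S T Y finite_subset by (auto simp: layered_def)
  have card_layers: "card A = (\<Sum>c\<in>snd ` Y. card {v. (v, c) \<in> A})" if A: "A \<subseteq> Y" for A
  proof -
    have fA: "finite A" using A Y finite_subset by blast
    have "bij_betw prod.swap A (Sigma (snd ` Y) (\<lambda>c. {v. (v, c) \<in> A}))"
      using A by (force simp: bij_betw_def inj_on_def image_iff)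
    then have "card A = card (Sigma (snd ` Y) (\<lambda>c. {v. (v, c) \<in> A}))" by (rule bij_betw_same_card)
    also have "\<dots> = (\<Sum>c\<in>snd ` Y. card {v. (v, c) \<in> A})"
    proof (rule card_SigmaI)
      have "{v. (v, c) \<in> A} \<subseteq> fst ` A" for c by force
      then show "\<forall>c\<in>snd ` Y. finite {v. (v, c) \<in> A}" using fA finite_subset by blast
    qed (use Y in auto)
    finally show ?thesis .
  qed
  have "(\<Sum>c\<in>snd ` Y. card {v. (v, c) \<in> S}) < (\<Sum>c\<in>snd ` Y. card {v. (v, c) \<in> T})"
    using less card_layers[of S] card_layers[of T] S T by (simp add: layered_def)
  then obtain c where "card {v. (v, c) \<in> S} < card {v. (v, c) \<in> T}"
    by (meson not_le sum_mono)
  then obtain v where v: "v \<in> {v. (v, c) \<in> T} - {v. (v, c) \<in> S}" "insert v {v. (v, c) \<in> S} \<in> M"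
    using matroid_augment[OF M] S T unfolding layered_def by blast
  have "{u. (u, d) \<in> insert (v, c) S} \<in> M" for d
  proof (cases "d = c")
    case True
    then have "{u. (u, d) \<in> insert (v, c) S} = insert v {v. (v, c) \<in> S}" by auto
    then show ?thesis using v by simp
  next
    case False
    then have "{u. (u, d) \<in> insert (v, c) S} = {u. (u, d) \<in> S}" by auto
    then show ?thesis using S by (simp add: layered_def)
  qed
  then have "insert (v, c) S \<in> layered Y M" using S T v by (auto simp: layered_def)
  then show "\<exists>y\<in>T - S. insert y S \<in> layered Y M" using v by blast
qed

text \<open>A covering set \<open>I\<close> lifts to all pairs over it, whose layers are subsets of
  \<open>I\<close>. Distinct sets may have equal lifts, hence only an inequality.\<close>

lemma layered_cover:
  assumes M: "matroid_on V M" and F: "F \<subseteq> M" "finite F" "\<Union>F = V" and Y: "fst ` Y \<subseteq> V"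
  obtains G where "G \<subseteq> layered Y M" "finite G" "\<Union>G = Y" "card G \<le> card F"
proof (rule that)
  let ?G = "(\<lambda>I. {y \<in> Y. fst y \<in> I}) ` F"
  show "?G \<subseteq> layered Y M"
  proof (intro image_subsetI)
    fix I assume "I \<in> F"
    then have "I \<in> M" using F(1) by blast
    then have "{v. (v, c) \<in> {y \<in> Y. fst y \<in> I}} \<in> M" for c
      by (rule matroid_subset[OF M]) auto
    then show "{y \<in> Y. fst y \<in> I} \<in> layered Y M" by (simp add: layered_def)
  qed
  show "finite ?G" using F(2) by simp
  show "card ?G \<le> card F" using F(2) by (rule card_image_le)
  show "\<Union>?G = Y" using F(3) Y by blast
qed

lemma list_colorable_matroid_intersection:
  fixes V :: "'a set"
  assumes M: "matroid_on V M" and F: "F \<subseteq> M" "finite F" "\<Union>F = V"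
    and N: "matroid_on V N" and H: "H \<subseteq> N" "finite H" "\<Union>H = V"
  shows "list_colorable V (M \<inter> N) (card F + card H)"
  unfolding list_colorable_def
proof (intro allI impI)
  fix L :: "'a \<Rightarrow> nat set"
  assume L: "\<forall>v\<in>V. finite (L v) \<and> card (L v) = card F + card H"
  have finV: "finite V" using matroid_finite[OF M] .
  define W where "W = Sigma V L"
  have finW: "finite W" using finV L by (auto simp: W_def)
  obtain a :: "'a \<Rightarrow> nat" where a: "inj_on a V"
    using finite_imp_inj_to_nat_seg[OF finV] by blast
  obtain B where B: "\<And>c. c \<in> snd ` W \<Longrightarrow> c < B"
    using finite_nat_set_iff_bounded[of "snd ` W"] finW by auto
  \<comment> \<open>A lexicographic code, vertex first and colour as remainder below
    \<open>B\<close>: it is injective on \<open>W\<close> and makes \<open>fst\<close>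
    monotone.\<close>
  define g where "g w = a (fst w) * B + snd w" for w :: "'a \<times> nat"
  have gdiv: "g w div B = a (fst w)" "g w mod B = snd w" if "w \<in> W" for w
    using B[of "snd w"] that by (auto simp: g_def)
  have g: "inj_on g W"
  proof (rule inj_onI)
    fix w w' assume w: "w \<in> W" "w' \<in> W" and eq: "g w = g w'"
    then have "a (fst w) = a (fst w')" "snd w = snd w'" using gdiv by metis+
    moreover have "fst w \<in> V" "fst w' \<in> V" using w by (auto simp: W_def)
    ultimately show "w = w'" using a by (auto simp: prod_eq_iff dest: inj_onD)
  qed
  have "\<exists>S\<in>layered W M \<inter> layered W N. inj_on fst S \<and> fst ` S = V"
  proof (rule exists_rainbow_face[OF finW g finV a])
    show "{} \<in> layered W M \<inter> layered W N"
      using M N complex_on_empty by (auto simp: layered_def matroid_on_def)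
    show "a (fst w) \<le> a (fst w')" if "w \<in> W" "w' \<in> W" "g w < g w'" for w w'
      using that gdiv div_le_mono[of "g w" "g w'" B] by simp
    show "\<forall>X\<subseteq>V. X \<noteq> {} \<longrightarrow> acyclic_over g W (layered W M \<inter> layered W N) fst X"
      unfolding acyclic_over_def
    proof (intro allI impI)
      fix X :: "'a set" and z
      assume X: "X \<subseteq> V" "X \<noteq> {}"
        and z: "\<forall>S. z S \<noteq> 0 \<longrightarrow>
          S \<in> layered W M \<inter> layered W N \<and> fst ` S \<subseteq> X \<and> Suc (card S) = card X"
        and cyc: "\<forall>S. bd g W z S = 0"
      define Y where "Y = Sigma X L"
      have YW: "Y \<subseteq> W" "fst ` Y \<subseteq> V" using X by (auto simp: Y_def W_def)
      note Y = YW(1) finite_subset[OF YW(1) finW] YW(2)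
      have SY: "S \<subseteq> Y \<longleftrightarrow> fst ` S \<subseteq> X" if "S \<subseteq> W" for S
        using that by (force simp: Y_def W_def)
      have mem: "S \<in> layered Y M \<inter> layered Y N \<longleftrightarrow>
          S \<in> layered W M \<inter> layered W N \<and> fst ` S \<subseteq> X" for S
        using SY[of S] Y(1) unfolding layered_def by blast
      obtain F' where F': "F' \<subseteq> layered Y M" "finite F'" "\<Union>F' = Y" "card F' \<le> card F"
        using layered_cover[OF M F Y(3)] .
      obtain H' where H': "H' \<subseteq> layered Y N" "finite H'" "\<Union>H' = Y" "card H' \<le> card H"
        using layered_cover[OF N H Y(3)] .
      define r where "r = card X - 1"
      have finX: "finite X" using X finV finite_subset by blast
      have r: "card X = Suc r" using finX X by (simp add: r_def card_gt_0_iff)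
      \<comment> \<open>A nonempty \<open>X\<close> forces a nonempty cover, so passing from
        \<open>r\<close> to \<open>card X = Suc r\<close> makes the bound \<open>big\<close>
        strict.\<close>
      have "F \<noteq> {}" using F X by auto
      then have "card F > 0" using F by (simp add: card_gt_0_iff)
      have "card Y = card X * (card F + card H)"
        using L X finX by (simp add: Y_def card_SigmaI subset_iff)
      then have big: "(card F' + card H') * r < card Y"
      proof -
        have "(card F' + card H') * r \<le> (card F + card H) * r"
          using F' H' by (intro mult_le_mono1) simp
        also have "\<dots> < card X * (card F + card H)" using r \<open>card F > 0\<close> by simp
        finally show ?thesis using \<open>card Y = _\<close> by simp
      qed
      \<comment> \<open>Acyclicity is stated with boundaries in \<open>W\<close> but proved in the
        lifted matroids on \<open>Y\<close>; on chains living over \<open>X\<close> the two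
        boundaries agree.\<close>
      have bdY: "bd g W \<phi> S = bd g Y \<phi> S" if "\<And>S. \<phi> S \<noteq> 0 \<Longrightarrow> S \<in> layered Y M" for \<phi> S
        by (rule bd_supported[OF finW Y(1)]) (use that in \<open>auto simp: layered_def\<close>)
      have zY: "z S \<noteq> 0 \<Longrightarrow> S \<in> layered Y M \<inter> layered Y N \<and> card S = r" for S
        using z mem r by auto
      have "bd g Y z S = 0" for S using cyc bdY[of z S] zY by auto
      then obtain w where w: "\<forall>S. w S \<noteq> 0 \<longrightarrow> S \<in> layered Y M \<inter> layered Y N \<and> card S = Suc r"
        "\<forall>S. bd g Y w S = z S"
        using matroid_intersection_acyclic[OF matroid_layered[OF M Y(2,3)] F'(1-3)
            matroid_layered[OF N Y(2,3)] H'(1-3) inj_on_subset[OF g Y(1)] big zY] by blast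
      have "S \<in> layered W M \<inter> layered W N \<and> fst ` S \<subseteq> X \<and> card S = card X" if "w S \<noteq> 0" for S
        using w(1) that unfolding mem r by blast
      moreover have "bd g W w S = z S" for S using bdY[of w S] w by auto
      ultimately show "\<exists>w. (\<forall>S. w S \<noteq> 0 \<longrightarrow>
          S \<in> layered W M \<inter> layered W N \<and> fst ` S \<subseteq> X \<and> card S = card X) \<and>
          (\<forall>S. bd g W w S = z S)"
        by blast
    qed
  qed
  then obtain S where S: "S \<in> layered W M" "S \<in> layered W N" "inj_on fst S" "fst ` S = V" by blast
  \<comment> \<open>\<open>S\<close> has exactly one pair over each vertex, so it is the graph of a
    function, and its layers are the colour classes.\<close>
  define f where "f v = snd (the_inv_into S fst v)" for v
  have f: "(v, c) \<in> S \<longleftrightarrow> v \<in> V \<and> f v = c" for v c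
  proof
    assume "(v, c) \<in> S"
    moreover from this have "the_inv_into S fst v = (v, c)"
      using the_inv_into_f_f[OF S(3), of "(v, c)"] by simp
    ultimately show "v \<in> V \<and> f v = c" using S(4) by (force simp: f_def)
  next
    assume v: "v \<in> V \<and> f v = c"
    then have "the_inv_into S fst v \<in> S" "fst (the_inv_into S fst v) = v"
      using S(3,4) the_inv_into_into[of fst S v S] f_the_inv_into_f[of fst S v] by auto
    then show "(v, c) \<in> S" using v by (metis f_def prod.collapse)
  qed
  have "f v \<in> L v" if "v \<in> V" for v
    using f[of v "f v"] that S(1) by (auto simp: layered_def W_def)
  moreover have "{v \<in> V. f v = c} \<in> M \<inter> N" for c
    using S(1,2) f by (simp add: layered_def)
  ultimately show "\<exists>f. (\<forall>v\<in>V. f v \<in> L v) \<and> (\<forall>c. {v \<in> V. f v = c} \<in> M \<inter> N)" by blast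
qed

theorem theorem1p2:
  fixes V :: "'a set" and M N :: "'a set set"
  assumes "matroid_on V M" and "matroid_on V N"
  shows "list_chromatic_number V (M \<inter> N) \<le> chromatic_number V M + chromatic_number V N"
proof -
  obtain F where F: "F \<subseteq> M" "finite F" "card F = chromatic_number V M" "\<Union>F = V"
    using assms(1) chromatic_number_attained unfolding matroid_on_def by metis
  obtain H where H: "H \<subseteq> N" "finite H" "card H = chromatic_number V N" "\<Union>H = V"
    using assms(2) chromatic_number_attained unfolding matroid_on_def by metis
  show ?thesis
    using list_colorable_matroid_intersection[OF assms(1) F(1,2,4) assms(2) H(1,2,4)] F(3) H(3)
    unfolding list_chromatic_number_def by (metis Least_le)
qed

end
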